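(* Let $p,q\ge 0$ be integers with $n=p+q\ge 1$, and let $\mathbb{C}\ell(p,q)$ denote either the real Clifford algebra $\mathbb{C}\ell^{\mathbb R}(p,q)$ or the complex Clifford algebra $\mathbb{C}\ell^{\mathbb C}(p,q)$. For $k=0,1,2,3$ let $\mathbb{C}\ell_{\overline k}(p,q)=\bigoplus_{j\equiv k \,(\mathrm{mod}\,4)}\mathbb{C}\ell_j(p,q)$, so that $\mathbb{C}\ell(p,q)=\mathbb{C}\ell_{\overline 0}(p,q)\oplus\mathbb{C}\ell_{\overline 1}(p,q)\oplus\mathbb{C}\ell_{\overline 2}(p,q)\oplus\mathbb{C}\ell_{\overline 3}(p,q)$. (a) $\mathbb{C}\ell(p,q)$ is an algebra of quaternion type with respect to the operation $U,V\mapsto\{U,V\}=UV+VU$, with $\mathbb E=\mathbb{C}\ell_{\overline 0}(p,q)$, $\mathbb I=\mathbb{C}\ell_{\overline 1}(p,q)$, $\mathbb J=\mathbb{C}\ell_{\overline 2}(p,q)$, $\mathbb K=\mathbb{C}\ell_{\overline 3}(p,q)$. (b) $\mathbb{C}\ell(p,q)$ is an algebra of quaternion type with respect to the operation $U,V\mapsto[U,V]=UV-VU$, with $\mathbb E=\mathbb{C}\ell_{\overline 2}(p,q)$, $\mathbb I=\mathbb{C}\ell_{\overline 3}(p,q)$, $\mathbb J=\mathbb{C}\ell_{\overline 0}(p,q)$, $\mathbb K=\mathbb{C}\ell_{\overline 1}(p,q)$.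
   Context: Clifford algebra: $\mathbb{C}\ell^{\mathbb R}(p,q)$ (resp. $\mathbb{C}\ell^{\mathbb C}(p,q)$) is the associative unital algebra over $\mathbb R$ (resp. $\mathbb C$) with identity $e$ and generators $e^1,\dots,e^n$ satisfying $e^ae^b+e^be^a=2\eta^{ab}e$, where $\eta=\|\eta^{ab}\|$ is the diagonal matrix with $p$ entries $+1$ and $q$ entries $-1$ on the diagonal; the $2^n$ elements $e$ and $e^{a_1\ldots a_k}=e^{a_1}\cdots e^{a_k}$ ($a_1<\dots<a_k$, $1\le k\le n$) form a basis. $\mathbb{C}\ell_k(p,q)$ is the subspace spanned (over the base field) by the basis elements $e^{a_1\ldots a_k}$ of length $k$ (with $\mathbb{C}\ell_0(p,q)$ spanned by $e$); $\mathbb{C}\ell_k(p,q)=\{0\}$ for $k>n$. Algebra of quaternion type: let $\mathbb A$ be a finite-dimensional algebra over $\mathbb R$ or $\mathbb C$, written as a vector space direct sum of four subspaces $\mathbb A=\mathbb E\oplus\mathbb I\oplus\mathbb J\oplus\mathbb K$. $\mathbb A$ is called an algebra of quaternion type with respect to an operation $\circ:\mathbb A\times\mathbb A\to\mathbb A$ (not required to be associative or commutative) if, writing $X\circ Y\subseteq Z$ to mean $x\circ y\in Z$ for all $x\in X,\ y\in Y$: $\mathbb E\circ\mathbb E,\ \mathbb I\circ\mathbb I,\ \mathbb J\circ\mathbb J,\ \mathbb K\circ\mathbb K\subseteq\mathbb E$; $\mathbb E\circ\mathbb I,\ \mathbb I\circ\mathbb E,\ \mathbb K\circ\mathbb J,\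 \mathbb J\circ\mathbb K\subseteq\mathbb I$; $\mathbb E\circ\mathbb J,\ \mathbb J\circ\mathbb E,\ \mathbb I\circ\mathbb K,\ \mathbb K\circ\mathbb I\subseteq\mathbb J$; $\mathbb E\circ\mathbb K,\ \mathbb K\circ\mathbb E,\ \mathbb I\circ\mathbb J,\ \mathbb J\circ\mathbb I\subseteq\mathbb K$. *)

theory Defs
  imports Complex_Main "HOL-Library.FuncSet"
begin

text \<open>
  Uniqueness of the components is stated for extensional families, since the values of \<open>f\<close>
  outside \<open>J\<close> are irrelevant.
\<close>

definition (in vector_space) direct_sum_decomp :: "'b set \<Rightarrow> 'i set \<Rightarrow> ('i \<Rightarrow> 'b set) \<Rightarrow> bool" where
  "direct_sum_decomp W J V \<longleftrightarrow>
     finite J \<and> subspace W \<and> (\<forall>j\<in>J. subspace (V j) \<and> V j \<subseteq> W) \<and>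
     (\<forall>x\<in>W. \<exists>!f. f \<in> (\<Pi>\<^sub>E j\<in>J. V j) \<and> x = (\<Sum>j\<in>J. f j))"

locale assoc_algebra = vector_space scale
  for scale :: "'k::field \<Rightarrow> 'a::ring \<Rightarrow> 'a" (infixr "*s" 75) +
  assumes scale_mult_left: "(c *s x) * y = c *s (x * y)"
    and scale_mult_right: "x * (c *s y) = c *s (x * y)"

text \<open>
  The operation \<open>opr\<close> is separate from the product of the algebra; it is not required to be
  associative or commutative.
\<close>

definition quaternion_type ::
  "('k::field \<Rightarrow> 'a::ring \<Rightarrow> 'a) \<Rightarrow> ('a \<Rightarrow> 'a \<Rightarrow> 'a) \<Rightarrow> 'a set \<Rightarrow> 'a set \<Rightarrow> 'a set \<Rightarrow> 'a set \<Rightarrow> bool"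
  where
  "quaternion_type scale opr E I J K \<longleftrightarrow>
     assoc_algebra scale \<and> (\<exists>B. finite_dimensional_vector_space scale B) \<and>
     vector_space.direct_sum_decomp scale UNIV {..<4::nat} (\<lambda>i. [E, I, J, K] ! i) \<and>
     (let sub = (\<lambda>X Y Z. \<forall>x\<in>X. \<forall>y\<in>Y. opr x y \<in> Z) in
       sub E E E \<and> sub I I E \<and> sub J J E \<and> sub K K E \<and>
       sub E I I \<and> sub I E I \<and> sub K J I \<and> sub J K I \<and>
       sub E J J \<and> sub J E J \<and> sub I K J \<and> sub K I J \<and>
       sub E K K \<and> sub K E K \<and> sub I J K \<and> sub J I K)"

definition eta :: "nat \<Rightarrow> nat \<Rightarrow> nat \<Rightarrow> 'k::field" where
  "eta p a b = (if a = b then if a \<le> p then 1 else - 1 else 0)"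

definition blade :: "(nat \<Rightarrow> 'a::ring_1) \<Rightarrow> nat set \<Rightarrow> 'a" where
  "blade e A = prod_list (map e (sorted_list_of_set A))"

text \<open>
  The identity of the algebra is \<open>1\<close>, the generators are \<open>e 1, \<dots>, e (p + q)\<close>; the values of \<open>e\<close>
  at other arguments are irrelevant. That the \<open>e a\<close> generate the algebra is part of the
  basis assumptions. Injectivity makes the \<open>2 ^ (p + q)\<close> basis elements distinct.
\<close>

locale clifford_algebra = assoc_algebra scale
  for scale :: "'k::field \<Rightarrow> 'a::ring_1 \<Rightarrow> 'a" (infixr "*s" 75)
    and p q :: nat and e :: "nat \<Rightarrow> 'a" +
  assumes clifford_relation:
      "\<lbrakk>a \<in> {1..p + q}; b \<in> {1..p + q}\<rbrakk> \<Longrightarrow> e a * e b + e b * e a = (2 * eta p a b) *s 1"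
    and inj_blade: "inj_on (blade e) (Pow {1..p + q})"
    and independent_blades: "independent (blade e ` Pow {1..p + q})"
    and span_blades: "span (blade e ` Pow {1..p + q}) = UNIV"
begin

definition grade :: "nat \<Rightarrow> 'a set" where
  "grade k = span (blade e ` {A. A \<subseteq> {1..p + q} \<and> card A = k})"

text \<open>
  The sum of the subspaces \<open>grade j\<close>, \<open>j mod 4 = k\<close>; it is direct by
  \<open>grade_mod4_direct\<close> below, where the zero summands \<open>j > p + q\<close> are left out.
\<close>

definition grade_mod4 :: "nat \<Rightarrow> 'a set" where
  "grade_mod4 k = span (\<Union>j\<in>{j. j mod 4 = k}. grade j)"

lemma grade_eq_0:
  assumes "k > p + q"
  shows "grade k = {0}"
proof -
  have "card A \<noteq> k" if "A \<subseteq> {1..p + q}" for A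
    using card_mono[OF _ that] assms by simp
  then have "{A. A \<subseteq> {1..p + q} \<and> card A = k} = {}" by blast
  then show ?thesis unfolding grade_def by (simp only: image_empty span_empty)
qed

lemma grade_sum_0:
  assumes J: "finite J" and h: "\<And>j. j \<in> J \<Longrightarrow> h j \<in> grade j" and s: "(\<Sum>j\<in>J. h j) = 0"
    and j: "j \<in> J"
  shows "h j = 0"
proof -
  let ?B = "blade e ` Pow {1..p + q}"
  let ?C = "\<lambda>k. blade e ` {A. A \<subseteq> {1..p + q} \<and> card A = k}"
  have sp: "\<And>x. x \<in> span ?B" by (simp only: span_blades UNIV_I)
  have off: "representation ?B (h i) b = 0" if "i \<in> J" "b \<notin> ?C i" for i b
  proof -
    have "representation ?B (h i) = representation (?C i) (h i)"
      by (rule representation_extend[OF independent_blades])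
        (use h[OF that(1)] in \<open>simp add: grade_def\<close>, blast)
    then show ?thesis using that(2) representation_ne_zero[of "?C i" "h i" b] by metis
  qed
  have disj: "b \<notin> ?C i" if bj: "b \<in> ?C j" and ne: "i \<noteq> j" for i b
  proof
    assume "b \<in> ?C i"
    then obtain A' where A': "b = blade e A'" "A' \<subseteq> {1..p + q}" "card A' = i" by blast
    obtain A where A: "b = blade e A" "A \<subseteq> {1..p + q}" "card A = j"
      using bj by blast
    have "A = A'" using inj_onD[OF inj_blade, of A A'] A A' by simp
    then show False using ne A A' by simp
  qed
  have "representation ?B (h j) b = 0" for b
  proof (cases "b \<in> ?C j")
    case True
    have "0 = representation ?B (\<Sum>i\<in>J. h i) b" by (simp add: s representation_zero)
    also have "\<dots> = (\<Sum>i\<in>J. representation ?B (h i) b)"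
      using representation_sum[OF independent_blades, of J h] sp by metis
    also have "\<dots> = (\<Sum>i\<in>J. if i = j then representation ?B (h j) b else 0)"
    proof (rule sum.cong)
      fix i assume "i \<in> J"
      then show "representation ?B (h i) b = (if i = j then representation ?B (h j) b else 0)"
        using off[of i b] disj[OF True, of i] by presburger
    qed simp
    also have "\<dots> = representation ?B (h j) b" using J j by simp
    finally show ?thesis by simp
  next
    case False
    with j show ?thesis by (rule off)
  qed
  then show ?thesis
    using sum_nonzero_representation_eq[OF independent_blades sp, of "h j"] by simp
qed

lemma grade_mod4_direct:
  "direct_sum_decomp (grade_mod4 k) {j. j \<le> p + q \<and> j mod 4 = k} grade"
proof -
  define J where "J = {j. j \<le> p + q \<and> j mod 4 = k}"
  define S where "S = {x. \<exists>f. f \<in> (\<Pi>\<^sub>E j\<in>J. grade j) \<and> x = (\<Sum>j\<in>J. f j)}"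
  have fin: "finite J" by (simp add: J_def)
  have sub: "subspace (grade j)" for j by (simp add: grade_def)
  have SI: "(\<Sum>j\<in>J. f j) \<in> S" if "\<And>j. j \<in> J \<Longrightarrow> f j \<in> grade j" for f
  proof -
    have "restrict f J \<in> (\<Pi>\<^sub>E j\<in>J. grade j)" using that by (simp add: restrict_PiE_iff)
    moreover have "(\<Sum>j\<in>J. f j) = (\<Sum>j\<in>J. restrict f J j)" by (rule sum.cong) simp_all
    ultimately show ?thesis unfolding S_def by blast
  qed
  have ss: "subspace S"
  proof (rule subspaceI)
    show "0 \<in> S" using SI[of "\<lambda>_. 0"] by (simp add: subspace_0[OF sub])
  next
    fix x y assume "x \<in> S" "y \<in> S"
    then obtain f g where "f \<in> (\<Pi>\<^sub>E j\<in>J. grade j)" "x = (\<Sum>j\<in>J. f j)"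
      "g \<in> (\<Pi>\<^sub>E j\<in>J. grade j)" "y = (\<Sum>j\<in>J. g j)" unfolding S_def by blast
    then show "x + y \<in> S"
      using SI[of "\<lambda>j. f j + g j"] by (simp add: sum.distrib PiE_mem subspace_add[OF sub])
  next
    fix c x assume "x \<in> S"
    then obtain f where "f \<in> (\<Pi>\<^sub>E j\<in>J. grade j)" "x = (\<Sum>j\<in>J. f j)"
      unfolding S_def by blast
    then show "c *s x \<in> S"
      using SI[of "\<lambda>j. c *s f j"] by (simp add: scale_sum_right PiE_mem subspace_scale[OF sub])
  qed
  have "grade j \<subseteq> S" if j: "j mod 4 = k" for j
  proof (cases "j \<le> p + q")
    case True
    then have jJ: "j \<in> J" using j by (simp add: J_def)
    show ?thesis
    proof
      fix x assume "x \<in> grade j"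
      then show "x \<in> S"
        using SI[of "\<lambda>i. if i = j then x else 0"] jJ fin by (simp add: subspace_0[OF sub])
    qed
  next
    case False
    then show ?thesis using grade_eq_0 subspace_0[OF ss] by simp
  qed
  then have "(\<Union>j\<in>{j. j mod 4 = k}. grade j) \<subseteq> S" by blast
  then have ex: "grade_mod4 k \<subseteq> S"
    unfolding grade_mod4_def by (rule span_minimal[OF _ ss])
  have uniq: "f = g"
    if f: "f \<in> (\<Pi>\<^sub>E j\<in>J. grade j)" and g: "g \<in> (\<Pi>\<^sub>E j\<in>J. grade j)"
      and eq: "(\<Sum>j\<in>J. f j) = (\<Sum>j\<in>J. g j)" for f g
  proof (rule PiE_ext[OF f g])
    fix j assume j: "j \<in> J"
    have "(\<Sum>j\<in>J. f j - g j) = 0" using eq by (simp add: sum_subtractf)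
    then have "f j - g j = 0"
      using grade_sum_0[OF fin _ _ j, of "\<lambda>j. f j - g j"] subspace_diff[OF sub]
        PiE_mem[OF f] PiE_mem[OF g] by simp
    then show "f j = g j" by simp
  qed
  have "\<exists>!f. f \<in> (\<Pi>\<^sub>E j\<in>J. grade j) \<and> x = (\<Sum>j\<in>J. f j)" if "x \<in> grade_mod4 k" for x
  proof -
    have "x \<in> S" using that ex by blast
    then show ?thesis unfolding S_def using uniq by blast
  qed
  moreover have "grade j \<subseteq> grade_mod4 k" if "j \<in> J" for j
  proof -
    have "grade j \<subseteq> (\<Union>j\<in>{j. j mod 4 = k}. grade j)" using that by (auto simp: J_def)
    then show ?thesis unfolding grade_mod4_def using span_superset by (rule subset_trans)
  qed
  moreover have "subspace (grade_mod4 k)" by (simp add: grade_mod4_def)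
  ultimately show ?thesis
    using fin sub unfolding direct_sum_decomp_def J_def[symmetric] by simp
qed

end

end

theory Submission
  imports Defs "HOL-Library.Disjoint_Sets"
begin

text \<open>
  For blades with index sets of sizes \<open>k\<close> and \<open>l\<close> meeting in \<open>m\<close> elements, \<open>e\<^sub>A e\<^sub>B\<close> is a multiple of
  the blade of the symmetric difference, which has length \<open>k + l - 2 m\<close>, and
  \<open>e\<^sub>A e\<^sub>B = (-1)\<^bsup>k l + m\<^esup> e\<^sub>B e\<^sub>A\<close>. So the anticommutator vanishes unless \<open>m \<equiv> k l (mod 2)\<close>, and
  then the length is \<open>k + l + 2 k l\<close> modulo 4; the commutator vanishes unless
  \<open>m \<equiv> k l + 1 (mod 2)\<close>, which shifts the length by 2. Both residues depend only on \<open>k\<close> and \<open>l\<close>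
  modulo 4, and the rest is bilinearity.
\<close>

section \<open>Linear algebra: direct sums from a partitioned basis, bilinear maps on spans\<close>

text \<open>The component at \<open>j\<close> is the part of the basis expansion supported on
  \<open>C j\<close>. It is unique because a coordinate at a vector of \<open>C j\<close> can only
  come from the \<open>j\<close>-th summand.\<close>

lemma (in vector_space) direct_sum_decomp_partition:
  assumes indep: "independent B" and J: "finite J"
    and disj: "disjoint_family_on C J" and B: "B = (\<Union>j\<in>J. C j)"
  shows "direct_sum_decomp (span B) J (\<lambda>j. span (C j))"
  unfolding direct_sum_decomp_def
proof (intro conjI ballI)
  fix x assume x: "x \<in> span B"
  let ?r = "representation B"
  have C_sub: "C j \<subseteq> B" if "j \<in> J" for j using that B by blast
  define f where
    "f = (\<lambda>j\<in>J. \<Sum>b\<in>{b. ?r x b \<noteq> 0} \<inter> C j. ?r x b *s b)"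
  have "f \<in> (\<Pi>\<^sub>E j\<in>J. span (C j))"
    unfolding f_def restrict_PiE_iff
    by (intro ballI span_sum span_scale span_base) simp
  moreover have "x = (\<Sum>j\<in>J. f j)"
  proof -
    have "x = (\<Sum>b | ?r x b \<noteq> 0. ?r x b *s b)"
      using sum_nonzero_representation_eq[OF indep x] by simp
    \<comment> \<open>The support of \<open>x\<close> lies in \<open>B\<close>, so the blocks
      \<open>C j\<close> cut it into disjoint pieces.\<close>
    also have "{b. ?r x b \<noteq> 0} = (\<Union>j\<in>J. {b. ?r x b \<noteq> 0} \<inter> C j)"
      using B representation_ne_zero[of B x] by blast
    also have "(\<Sum>b\<in>\<dots>. ?r x b *s b) = (\<Sum>j\<in>J. \<Sum>b\<in>{b. ?r x b \<noteq> 0} \<inter> C j. ?r x b *s b)"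
      using disj by (intro sum.UNION_disjoint J)
        (auto simp: finite_representation disjoint_family_on_def)
    also have "\<dots> = (\<Sum>j\<in>J. f j)" by (simp add: f_def)
    finally show ?thesis .
  qed
  moreover have "g = f"
    if g: "g \<in> (\<Pi>\<^sub>E j\<in>J. span (C j))" "x = (\<Sum>j\<in>J. g j)"
      and f: "f \<in> (\<Pi>\<^sub>E j\<in>J. span (C j))" "x = (\<Sum>j\<in>J. f j)" for f g
  proof (rule PiE_ext[OF g(1) f(1)])
    fix j assume j: "j \<in> J"
    \<comment> \<open>In any decomposition \<open>h\<close> of \<open>x\<close>, the coordinates of
      \<open>h j\<close> are those of \<open>x\<close> cut off to \<open>C j\<close>, so
      \<open>x\<close> determines \<open>h j\<close>. This is applied to both \<open>g\<close> and
      \<open>f\<close>.\<close>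
    have rep: "?r (h j) b = (if b \<in> C j then ?r x b else 0)"
      if h: "h \<in> (\<Pi>\<^sub>E j\<in>J. span (C j))" "x = (\<Sum>j\<in>J. h j)" for h b
    proof -
      have mem: "h i \<in> span (C i)" "h i \<in> span B" if "i \<in> J" for i
        using PiE_mem[OF h(1) that] span_mono[OF C_sub[OF that]] by auto
      \<comment> \<open>The expansion of \<open>h i\<close> over \<open>B\<close> is already its
        expansion over \<open>C i\<close>.\<close>
      have off: "?r (h i) b = 0" if "i \<in> J" "b \<notin> C i" for i b
        using representation_extend[OF indep mem(1) C_sub] representation_ne_zero that by metis
      show ?thesis
      proof (cases "b \<in> C j")
        case True
        have "?r x b = (\<Sum>i\<in>J. ?r (h i) b)"
          using representation_sum[OF indep, of J h] mem(2) h(2) by simp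
        also have "\<dots> = (\<Sum>i\<in>J. if i = j then ?r (h j) b else 0)"
          using True disj j by (intro sum.cong refl) (auto intro!: off simp: disjoint_family_on_def)
        finally show ?thesis using True J j by simp
      qed (simp add: off j)
    qed
    have "h j = (\<Sum>b | ?r (h j) b \<noteq> 0. ?r (h j) b *s b)"
      if "h \<in> (\<Pi>\<^sub>E j\<in>J. span (C j))" for h
      using sum_nonzero_representation_eq[OF indep, of "h j"] PiE_mem[OF that j]
        span_mono[OF C_sub[OF j]] by auto
    from this[OF g(1)] this[OF f(1)] show "g j = f j"
      by (simp only: rep[OF g] rep[OF f])
  qed
  ultimately show "\<exists>!f. f \<in> (\<Pi>\<^sub>E j\<in>J. span (C j)) \<and> x = (\<Sum>j\<in>J. f j)" by blast
next
  fix j assume "j \<in> J"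
  then show "span (C j) \<subseteq> span B" using B by (intro span_mono) blast
qed (simp_all add: J)

lemma (in vector_space) direct_sum_decomp_cong:
  assumes "\<And>j. j \<in> J \<Longrightarrow> V j = V' j"
  shows "direct_sum_decomp W J V = direct_sum_decomp W J V'"
proof -
  have "(\<Pi>\<^sub>E j\<in>J. V j) = (\<Pi>\<^sub>E j\<in>J. V' j)" using assms by (rule PiE_cong)
  then show ?thesis using assms by (simp add: direct_sum_decomp_def)
qed

text \<open>One argument at a time: the preimage of \<open>W\<close> under a linear map is a
  subspace, so it contains a span as soon as it contains the generators.\<close>

lemma (in vector_space) bilinear_span_mem:
  assumes left: "\<And>y. Vector_Spaces.linear scale scale (\<lambda>x. f x y)"
    and right: "\<And>x. Vector_Spaces.linear scale scale (f x)"
    and W: "subspace W" and ST: "\<And>s t. \<lbrakk>s \<in> S; t \<in> T\<rbrakk> \<Longrightarrow> f s t \<in> W"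
    and x: "x \<in> span S" and y: "y \<in> span T"
  shows "f x y \<in> W"
proof -
  have "f s y \<in> W" if "s \<in> S" for s
  proof -
    interpret Vector_Spaces.linear scale scale "f s" by (rule right)
    show ?thesis using span_minimal[OF _ subspace_vimage[OF W], of T] ST[OF that] y by blast
  qed
  then have "S \<subseteq> (\<lambda>x. f x y) -` W" by blast
  moreover have "subspace ((\<lambda>x. f x y) -` W)"
  proof -
    interpret Vector_Spaces.linear scale scale "\<lambda>x. f x y" by (rule left)
    show ?thesis by (rule subspace_vimage[OF W])
  qed
  ultimately show ?thesis using span_minimal x by blast
qed

context assoc_algebra
begin

lemma linear_anticommutator:
  "Vector_Spaces.linear scale scale (\<lambda>x. x * y + y * x)"
  "Vector_Spaces.linear scale scale (\<lambda>y. x * y + y * x)"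
  by unfold_locales (simp_all add: algebra_simps scale_mult_left scale_mult_right)

lemma linear_commutator:
  "Vector_Spaces.linear scale scale (\<lambda>x. x * y - y * x)"
  "Vector_Spaces.linear scale scale (\<lambda>y. x * y - y * x)"
  by unfold_locales (simp_all add: algebra_simps scale_mult_left scale_mult_right)

end

section \<open>Blades as ordered products, and parity arithmetic\<close>

lemma blade_empty [simp]: "blade e {} = 1"
  by (simp add: blade_def)

text \<open>Factors are taken in increasing order, so a new least index contributes the leftmost
  one. This drives the inductions on index sets below.\<close>

lemma blade_insert_min:
  assumes "finite A" and "\<And>b. b \<in> A \<Longrightarrow> a < b"
  shows "blade e (insert a A) = e a * blade e A"
proof -
  have "a \<notin> A" using assms(2) by blast
  have "sorted_list_of_set (insert a A) = a # sorted_list_of_set A"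
    using assms \<open>a \<notin> A\<close> by (simp add: insort_is_Cons less_imp_le)
  then show ?thesis by (simp add: blade_def)
qed

lemma card_sym_diff_Int:
  assumes "finite A" "finite B"
  shows "card (sym_diff A B) + 2 * card (A \<inter> B) = card A + card B"
proof -
  have "card (sym_diff A B) = card (A - B) + card (B - A)"
    using assms by (intro card_Un_disjoint) auto
  then show ?thesis
    using card_Diff_subset_Int[of A B] card_Diff_subset_Int[of B A]
      card_mono[of A "A \<inter> B"] card_mono[of B "A \<inter> B"] assms by (simp add: Int_commute)
qed

lemma neg_one_power_cong:
  "even m = even n \<Longrightarrow> (- 1 :: 'a::ring_1) ^ m = (- 1) ^ n"
  by (simp add: minus_one_power_iff)

lemma mod_4_double_cong:
  fixes a m t :: nat
  assumes "even (t + m)"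
  shows "(a + 2 * t) mod 4 = (a + 2 * m) mod 4"
  using assms by presburger

section \<open>The sign by which two blades commute\<close>

context clifford_algebra
begin

lemma gen_anticommute:
  assumes "a \<in> {1..p + q}" "b \<in> {1..p + q}" "a \<noteq> b"
  shows "e a * e b = - (e b * e a)"
  using clifford_relation[OF assms(1,2)] assms(3) by (simp add: eta_def eq_neg_iff_add_eq_0)

text \<open>Moving \<open>e a\<close> through the product, each factor with another index costs one
  sign, while \<open>e a\<close> commutes with itself.\<close>

lemma gen_mult_prod_list:
  assumes "a \<in> {1..p + q}" "set xs \<subseteq> {1..p + q}"
  shows "e a * prod_list (map e xs) =
    (- 1) ^ length (filter (\<lambda>b. b \<noteq> a) xs) * (prod_list (map e xs) * e a)"
  using assms(2)
proof (induction xs)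
  case (Cons b xs)
  let ?P = "prod_list (map e xs)" and ?N = "length (filter (\<lambda>b. b \<noteq> a) xs)"
  have IH: "e a * ?P = (- 1) ^ ?N * (?P * e a)" using Cons by simp
  \<comment> \<open>Powers of \<open>- 1\<close> are central in the ring.\<close>
  have swap: "e b * ((- 1) ^ ?N * y) = (- 1) ^ ?N * (e b * y)" for y
    by (cases "even ?N") simp_all
  have "e a * (e b * ?P) = (if b = a then 1 else - 1) * (e b * (e a * ?P))"
    using gen_anticommute[OF assms(1), of b] Cons.prems by (auto simp flip: mult.assoc)
  then show ?case by (simp add: IH swap mult.assoc)
qed simp

lemma gen_mult_blade:
  assumes "a \<in> {1..p + q}" "A \<subseteq> {1..p + q}"
  shows "e a * blade e A = (- 1) ^ card (A - {a}) * (blade e A * e a)"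
proof -
  have fin: "finite A" using assms(2) finite_subset by blast
  \<comment> \<open>The sorted list has no repetitions, so the sign changes are counted by a
    cardinality.\<close>
  have "length (filter (\<lambda>b. b \<noteq> a) (sorted_list_of_set A)) = card (A - {a})"
  proof -
    have "length (filter (\<lambda>b. b \<noteq> a) (sorted_list_of_set A)) =
      card (set (filter (\<lambda>b. b \<noteq> a) (sorted_list_of_set A)))"
      by (intro distinct_card[symmetric]) simp
    also have "set (filter (\<lambda>b. b \<noteq> a) (sorted_list_of_set A)) = A - {a}" using fin by auto
    finally show ?thesis .
  qed
  then show ?thesis
    using gen_mult_prod_list[OF assms(1), of "sorted_list_of_set A"] assms(2) fin
    by (simp add: blade_def)
qed

text \<open>Induction on \<open>A\<close>, adding a new least index \<open>a\<close>:
  \<open>e a\<close> passes \<open>blade e B\<close> with sign exponent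
  \<open>card (B - {a})\<close>.\<close>

lemma blade_mult_commute:
  assumes "A \<subseteq> {1..p + q}" "B \<subseteq> {1..p + q}"
  shows "blade e A * blade e B =
    (- 1) ^ (card A * card B + card (A \<inter> B)) * (blade e B * blade e A)"
proof -
  have finB: "finite B" using assms(2) finite_subset by blast
  have "finite A" using assms(1) finite_subset by blast
  then show ?thesis using assms(1)
  proof (induction A rule: finite_linorder_min_induct)
    case (insert a A)
    let ?N = "card A * card B + card (A \<inter> B)" and ?M = "card (B - {a})"
    have a: "a \<in> {1..p + q}" "a \<notin> A" using insert by auto
    have IH: "blade e A * blade e B = (- 1) ^ ?N * (blade e B * blade e A)"
      using insert by simp
    have ins: "blade e (insert a A) = e a * blade e A"
      using insert.hyps by (intro blade_insert_min) auto
    \<comment> \<open>Enlarging \<open>A\<close> by \<open>a\<close> raises the exponent by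
      \<open>card B\<close>, plus one if \<open>a \<in> B\<close>; \<open>?M\<close> is
      \<open>card B\<close>, minus one if \<open>a \<in> B\<close>. The two agree modulo 2.\<close>
    have par: "even (?N + ?M) =
        even (card (insert a A) * card B + card (insert a A \<inter> B))"
    proof (cases "a \<in> B")
      case True
      then have "even ?M = odd (card B)" using card_Suc_Diff1[OF finB True] by fastforce
      moreover have "card (insert a A \<inter> B) = Suc (card (A \<inter> B))"
        using True a(2) insert.hyps by simp
      moreover have "card (insert a A) = Suc (card A)" using a(2) insert.hyps by simp
      ultimately show ?thesis by (simp only: even_add even_mult_iff even_Suc) blast
    qed (use a insert.hyps in auto)
    have swap: "e a * ((- 1) ^ ?N * y) = (- 1) ^ ?N * (e a * y)" for y
      by (cases "even ?N") simp_all
    have "blade e (insert a A) * blade e B = e a * (blade e A * blade e B)"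
      by (simp add: ins mult.assoc)
    also have "\<dots> = (- 1) ^ ?N * ((e a * blade e B) * blade e A)"
      by (simp add: IH swap mult.assoc)
    also have "\<dots> = (- 1) ^ (?N + ?M) * (blade e B * blade e (insert a A))"
      by (simp add: gen_mult_blade[OF a(1) assms(2)] ins power_add mult.assoc)
    finally show ?case by (simp only: neg_one_power_cong[OF par])
  qed simp
qed

section \<open>Products of blades as multiples of blades\<close>

text \<open>\<open>e a\<close> moves right past the smaller generators until the list is sorted,
  each swap costing a sign. Membership in the span of a singleton hides the resulting
  scalar.\<close>

lemma prod_list_insort:
  assumes "a \<in> {1..p + q}" "set xs \<subseteq> {1..p + q}" "a \<notin> set xs"
  shows "e a * prod_list (map e xs) \<in> span {prod_list (map e (insort a xs))}"
  using assms(2,3)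
proof (induction xs)
  case Nil
  show ?case by (simp add: span_base)
next
  case (Cons b xs)
  show ?case
  proof (cases "a \<le> b")
    case True
    then show ?thesis by (simp add: span_base)
  next
    case False
    obtain c where c: "e a * prod_list (map e xs) = c *s prod_list (map e (insort a xs))"
      using Cons by (auto simp: span_singleton)
    have "e a * (e b * prod_list (map e xs)) = - (e b * (e a * prod_list (map e xs)))"
      using gen_anticommute[OF assms(1), of b] Cons.prems by (simp flip: mult.assoc)
    also have "\<dots> = (- c) *s (e b * prod_list (map e (insort a xs)))"
      by (simp add: c scale_mult_right)
    finally show ?thesis using False by (simp add: span_base span_scale span_neg)
  qed
qed

lemma gen_mult_blade_notin:
  assumes "a \<in> {1..p + q}" "A \<subseteq> {1..p + q}" "a \<notin> A"
  shows "e a * blade e A \<in> span {blade e (insert a A)}"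
proof -
  have fin: "finite A" using assms(2) finite_subset by blast
  have "sorted_list_of_set (insert a A) = insort a (sorted_list_of_set A)"
    using fin assms(3) by simp
  then show ?thesis
    using prod_list_insort[of a "sorted_list_of_set A"] assms fin by (simp add: blade_def)
qed


text \<open>The Clifford relation with equal indices gives twice the claim; the factor 2 cancels
  because it is nonzero in the field.\<close>

lemma gen_square:
  assumes "(2 :: 'k) \<noteq> 0" "a \<in> {1..p + q}"
  shows "e a * e a = eta p a a *s 1"
proof -
  have "2 *s (e a * e a) = e a * e a + e a * e a"
    using scale_left_distrib[of 1 1 "e a * e a"] by simp
  then have "2 *s (e a * e a) = 2 *s (eta p a a *s 1)"
    using clifford_relation[OF assms(2,2)] by simp
  then show ?thesis using assms(1) scale_cancel_left by blast
qed

text \<open>Reduces to the case of an absent index without tracking positions: with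
  \<open>C = A - {a}\<close>, \<open>e a * blade e C\<close> is \<open>c\<close> times
  \<open>blade e A\<close>, and a second multiplication by \<open>e a\<close> brings back
  \<open>blade e C\<close> up to sign. It remains to divide by \<open>c\<close>.\<close>

lemma gen_mult_blade_in:
  assumes two: "(2 :: 'k) \<noteq> 0" and a: "a \<in> {1..p + q}" and A: "A \<subseteq> {1..p + q}" "a \<in> A"
  shows "e a * blade e A \<in> span {blade e (A - {a})}"
proof -
  define C where "C = A - {a}"
  have C: "C \<subseteq> {1..p + q}" "a \<notin> C" "insert a C = A" using A by (auto simp: C_def)
  obtain c where c: "e a * blade e C = c *s blade e A"
    using gen_mult_blade_notin[OF a C(1,2)] C(3) by (auto simp: span_singleton)
  have "c *s (e a * blade e A) = e a * (e a * blade e C)"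
    by (simp add: c scale_mult_right)
  also have "\<dots> = eta p a a *s blade e C"
    using gen_square[OF two a] by (simp add: scale_mult_left flip: mult.assoc)
  finally have eq: "c *s (e a * blade e A) = eta p a a *s blade e C" .
  have "blade e C \<noteq> 0"
    using independent_blades dependent_zero[of "blade e ` Pow {1..p + q}"] C(1) by (metis PowI image_eqI)
  \<comment> \<open>For \<open>c = 0\<close> the left side of \<open>eq\<close> would vanish, but
    \<open>eta p a a\<close> is 1 or -1 and \<open>blade e C\<close> is nonzero as a member of an
    independent set.\<close>
  then have "c \<noteq> 0" using eq by (auto simp: eta_def split: if_splits)
  then have "e a * blade e A = inverse c *s (c *s (e a * blade e A))" by simp
  also have "\<dots> = (inverse c * eta p a a) *s blade e C" by (simp only: eq scale_scale)
  finally have "e a * blade e A = (inverse c * eta p a a) *s blade e C" .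
  then show ?thesis by (auto simp: span_singleton C_def)
qed

lemma gen_mult_blade_sym_diff:
  assumes "(2 :: 'k) \<noteq> 0" "a \<in> {1..p + q}" "A \<subseteq> {1..p + q}"
  shows "e a * blade e A \<in> span {blade e (sym_diff {a} A)}"
proof (cases "a \<in> A")
  case True
  moreover from this have "sym_diff {a} A = A - {a}" by auto
  ultimately show ?thesis using gen_mult_blade_in[OF assms] by simp
next
  case False
  moreover from this have "sym_diff {a} A = insert a A" by auto
  ultimately show ?thesis using gen_mult_blade_notin[OF assms(2,3)] by simp
qed

text \<open>The generators of \<open>A\<close> are multiplied onto \<open>blade e B\<close> from the
  largest index down, and each one toggles its index in the current index set.\<close>

lemma blade_mult:
  assumes two: "(2 :: 'k) \<noteq> 0" and "A \<subseteq> {1..p + q}" and B: "B \<subseteq> {1..p + q}"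
  shows "blade e A * blade e B \<in> span {blade e (sym_diff A B)}"
proof -
  have "finite A" using assms(2) finite_subset by blast
  then show ?thesis using assms(2)
  proof (induction A rule: finite_linorder_min_induct)
    case empty
    then show ?case by (simp add: span_base)
  next
    case (insert a A)
    have a: "a \<in> {1..p + q}" "a \<notin> A" using insert by auto
    obtain c where c: "blade e A * blade e B = c *s blade e (sym_diff A B)"
      using insert by (auto simp: span_singleton)
    have "blade e (insert a A) * blade e B = e a * (blade e A * blade e B)"
      using insert.hyps by (subst blade_insert_min) (auto simp: mult.assoc)
    also have "\<dots> = c *s (e a * blade e (sym_diff A B))"
      by (simp add: c scale_mult_right)
    also have "\<dots> \<in> span {blade e (sym_diff {a} (sym_diff A B))}"
      using insert.prems B by (intro span_scale gen_mult_blade_sym_diff[OF two a(1)]) auto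
    also have "sym_diff {a} (sym_diff A B) = sym_diff (insert a A) B" using a by auto
    finally show ?case .
  qed
qed

section \<open>Brackets of the graded components modulo 4\<close>

text \<open>Turns the sum of graded pieces into the span of a set of blades, the form required by
  the bilinearity argument and by the partition of the basis.\<close>

lemma grade_mod4_eq_span:
  assumes "k < 4"
  shows "grade_mod4 k = span (blade e ` {A. A \<subseteq> {1..p + q} \<and> card A mod 4 = k})"
    (is "_ = span ?S")
proof
  have "grade j \<subseteq> span ?S" if "j mod 4 = k" for j
    unfolding grade_def using that by (intro span_mono) auto
  then show "grade_mod4 k \<subseteq> span ?S"
    unfolding grade_mod4_def by (intro span_minimal) auto
  have "?S \<subseteq> (\<Union>j\<in>{j. j mod 4 = k}. grade j)"
    unfolding grade_def by (auto intro!: span_base)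
  then show "span ?S \<subseteq> grade_mod4 k"
    unfolding grade_mod4_def by (rule span_mono)
qed

lemma blade_mult_grade_mod4:
  assumes "(2 :: 'k) \<noteq> 0" and A: "A \<subseteq> {1..p + q}" and B: "B \<subseteq> {1..p + q}"
  shows "blade e A * blade e B \<in> grade_mod4 ((card A + card B + 2 * card (A \<inter> B)) mod 4)"
proof -
  let ?D = "sym_diff A B" and ?k = "(card A + card B + 2 * card (A \<inter> B)) mod 4"
  have "card ?D + 2 * card (A \<inter> B) = card A + card B"
    using finite_subset[OF A] finite_subset[OF B] by (intro card_sym_diff_Int) simp_all
  \<comment> \<open>Modulo 4, subtracting twice the intersection is the same as adding it, which
    avoids subtraction of naturals.\<close>
  then have "card A + card B + 2 * card (A \<inter> B) = card ?D + 4 * card (A \<inter> B)" by linarith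
  then have "card ?D mod 4 = ?k" by simp
  then have "?D \<in> {C. C \<subseteq> {1..p + q} \<and> card C mod 4 = ?k}" using A B by blast
  then have "span {blade e ?D} \<subseteq> grade_mod4 ?k"
    unfolding grade_mod4_eq_span[OF mod_less_divisor[OF zero_less_numeral]]
    by (intro span_mono) blast
  then show ?thesis using blade_mult[OF assms] by blast
qed

lemma subspace_grade_mod4: "subspace (grade_mod4 k)"
  by (simp add: grade_mod4_def)

text \<open>With an even sign exponent, both products lie in one component, as its index is
  symmetric in \<open>A\<close> and \<open>B\<close>, and doubling turns the parity of
  \<open>card (A \<inter> B)\<close> into a residue modulo 4. With an odd exponent the products
  cancel.\<close>

lemma blade_anticommutator_grade_mod4:
  assumes "(2 :: 'k) \<noteq> 0" and A: "A \<subseteq> {1..p + q}" and B: "B \<subseteq> {1..p + q}"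
  shows "blade e A * blade e B + blade e B * blade e A \<in>
    grade_mod4 ((card A + card B + 2 * (card A * card B)) mod 4)"
proof (cases "even (card A * card B + card (A \<inter> B))")
  case True
  then have "(card A + card B + 2 * (card A * card B)) mod 4 =
      (card A + card B + 2 * card (A \<inter> B)) mod 4"
    by (rule mod_4_double_cong)
  then show ?thesis
    using blade_mult_grade_mod4[OF assms] blade_mult_grade_mod4[OF assms(1) B A]
    by (simp add: add.commute[of "card B"] Int_commute[of B] subspace_add[OF subspace_grade_mod4])
next
  case False
  then show ?thesis
    using blade_mult_commute[OF A B] by (simp add: subspace_0[OF subspace_grade_mod4])
qed

lemma blade_commutator_grade_mod4:
  assumes "(2 :: 'k) \<noteq> 0" and A: "A \<subseteq> {1..p + q}" and B: "B \<subseteq> {1..p + q}"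
  shows "blade e A * blade e B - blade e B * blade e A \<in>
    grade_mod4 ((card A + card B + 2 * (card A * card B) + 2) mod 4)"
proof (cases "even (card A * card B + card (A \<inter> B))")
  case True
  then show ?thesis
    using blade_mult_commute[OF A B] by (simp add: subspace_0[OF subspace_grade_mod4])
next
  case False
  \<comment> \<open>Now \<open>card (A \<inter> B)\<close> has the parity of
    \<open>card A * card B + 1\<close>; doubling that 1 gives the extra 2.\<close>
  then have "(card A + card B + 2 * (card A * card B) + 2) mod 4 =
      (card A + card B + 2 * card (A \<inter> B)) mod 4"
    using mod_4_double_cong[of "card A * card B + 1" "card (A \<inter> B)" "card A + card B"]
    by (simp add: algebra_simps)
  then show ?thesis
    using blade_mult_grade_mod4[OF assms] blade_mult_grade_mod4[OF assms(1) B A]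
    by (simp add: add.commute[of "card B"] Int_commute[of B] subspace_diff[OF subspace_grade_mod4])
qed

lemma anticommutator_grade_mod4:
  assumes two: "(2 :: 'k) \<noteq> 0" and "k < 4" "l < 4" "x \<in> grade_mod4 k" "y \<in> grade_mod4 l"
  shows "x * y + y * x \<in> grade_mod4 ((k + l + 2 * (k * l)) mod 4)"
proof (rule bilinear_span_mem[OF linear_anticommutator subspace_grade_mod4,
      where x = x and y = y])
  show "x \<in> span (blade e ` {A. A \<subseteq> {1..p + q} \<and> card A mod 4 = k})"
    "y \<in> span (blade e ` {A. A \<subseteq> {1..p + q} \<and> card A mod 4 = l})"
    using assms grade_mod4_eq_span by auto
next
  fix s t
  assume "s \<in> blade e ` {A. A \<subseteq> {1..p + q} \<and> card A mod 4 = k}"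
    "t \<in> blade e ` {A. A \<subseteq> {1..p + q} \<and> card A mod 4 = l}"
  then obtain A B where "s = blade e A" "A \<subseteq> {1..p + q}" "card A mod 4 = k"
    "t = blade e B" "B \<subseteq> {1..p + q}" "card B mod 4 = l" by blast
  \<comment> \<open>Sums and products respect congruence, so the cardinalities may be replaced by
    their residues \<open>k\<close> and \<open>l\<close>.\<close>
  moreover from this have "(card A + card B + 2 * (card A * card B)) mod 4 =
      (k + l + 2 * (k * l)) mod 4"
    by (intro mod_add_cong mod_mult_cong refl) auto
  ultimately show "s * t + t * s \<in> grade_mod4 ((k + l + 2 * (k * l)) mod 4)"
    using blade_anticommutator_grade_mod4[OF two, of A B] by simp
qed

lemma commutator_grade_mod4:
  assumes two: "(2 :: 'k) \<noteq> 0" and "k < 4" "l < 4" "x \<in> grade_mod4 k" "y \<in> grade_mod4 l"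
  shows "x * y - y * x \<in> grade_mod4 ((k + l + 2 * (k * l) + 2) mod 4)"
proof (rule bilinear_span_mem[OF linear_commutator subspace_grade_mod4,
      where x = x and y = y])
  show "x \<in> span (blade e ` {A. A \<subseteq> {1..p + q} \<and> card A mod 4 = k})"
    "y \<in> span (blade e ` {A. A \<subseteq> {1..p + q} \<and> card A mod 4 = l})"
    using assms grade_mod4_eq_span by auto
next
  fix s t
  assume "s \<in> blade e ` {A. A \<subseteq> {1..p + q} \<and> card A mod 4 = k}"
    "t \<in> blade e ` {A. A \<subseteq> {1..p + q} \<and> card A mod 4 = l}"
  then obtain A B where "s = blade e A" "A \<subseteq> {1..p + q}" "card A mod 4 = k"
    "t = blade e B" "B \<subseteq> {1..p + q}" "card B mod 4 = l" by blast
  moreover from this have "(card A + card B + 2 * (card A * card B) + 2) mod 4 =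
      (k + l + 2 * (k * l) + 2) mod 4"
    by (intro mod_add_cong mod_mult_cong refl) auto
  ultimately show "s * t - t * s \<in> grade_mod4 ((k + l + 2 * (k * l) + 2) mod 4)"
    using blade_commutator_grade_mod4[OF two, of A B] by simp
qed

section \<open>The decomposition into four components and the multiplication tables\<close>

text \<open>Sorting the basis blades by length modulo 4 partitions the basis. The bijection
  \<open>s\<close> allows the two orders of the components that the two brackets call for.\<close>

lemma direct_sum_decomp_grade_mod4:
  assumes "bij_betw s {..<4} {..<4::nat}"
  shows "direct_sum_decomp UNIV {..<4::nat} (\<lambda>i. grade_mod4 (s i))"
proof -
  let ?C = "\<lambda>i. blade e ` {A. A \<subseteq> {1..p + q} \<and> card A mod 4 = s i}"
  have s: "s i < 4" if "i < 4" for i using bij_betwE[OF assms] that by simp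
  have disj: "disjoint_family_on ?C {..<4}"
    unfolding disjoint_family_on_def
  proof (intro ballI impI)
    fix i j :: nat assume ij: "i \<in> {..<4}" "j \<in> {..<4}" "i \<noteq> j"
    then have "s i \<noteq> s j" using assms by (auto simp: bij_betw_def dest: inj_onD)
    \<comment> \<open>By injectivity of \<open>blade e\<close>, a common blade would have a single
      index set, whose cardinality would have two residues.\<close>
    then show "?C i \<inter> ?C j = {}" using inj_onD[OF inj_blade] by fastforce
  qed
  have "\<exists>i<4. card A mod 4 = s i" for A :: "nat set"
  proof -
    have "card A mod 4 \<in> s ` {..<4}" using assms by (simp add: bij_betw_def)
    then show ?thesis by blast
  qed
  then have "blade e ` Pow {1..p + q} = (\<Union>i\<in>{..<4}. ?C i)" by fastforce
  from direct_sum_decomp_partition[OF independent_blades _ disj this]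
  have "direct_sum_decomp UNIV {..<4} (\<lambda>i. span (?C i))" by (simp only: span_blades finite_lessThan)
  then show ?thesis
    using direct_sum_decomp_cong[of "{..<4}" "\<lambda>i. grade_mod4 (s i)" "\<lambda>i. span (?C i)"]
      grade_mod4_eq_span[OF s] by simp
qed

lemma direct_sum_decomp_grade_mod4_nth:
  assumes "distinct ks" "set ks = {..<4}"
  shows "direct_sum_decomp UNIV {..<4::nat} (\<lambda>i. map grade_mod4 ks ! i)"
proof -
  have len: "length ks = 4" using distinct_card[OF assms(1)] assms(2) by simp
  have "map grade_mod4 ks ! i = grade_mod4 (ks ! i)" if "i \<in> {..<4}" for i
    using that len by (intro nth_map) simp
  moreover have "bij_betw ((!) ks) {..<4} {..<4}"
    using assms len by (intro bij_betw_nth) simp_all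
  ultimately show ?thesis
    by (rule iffD2[OF direct_sum_decomp_cong direct_sum_decomp_grade_mod4])
qed

lemma finite_dimensional: "finite_dimensional_vector_space scale (blade e ` Pow {1..p + q})"
  by (intro finite_dimensional_vector_space.intro finite_dimensional_vector_space_axioms.intro
      vector_space_axioms independent_blades span_blades) simp

text \<open>On the residues 0, 1, 2, 3 the operation \<open>(k + l + 2 * (k * l)) mod 4\<close> is
  bitwise exclusive or: the Klein four-group with identity 0, which is the table required of E, I,
  J, K.\<close>

lemma quaternion_type_anticommutator:
  assumes "(2 :: 'k) \<noteq> 0"
  shows "quaternion_type scale (\<lambda>U V. U * V + V * U)
    (grade_mod4 0) (grade_mod4 1) (grade_mod4 2) (grade_mod4 3)"
proof -
  have direct: "direct_sum_decomp UNIV {..<4} (\<lambda>i. map grade_mod4 [0, 1, 2, 3] ! i)"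
    by (rule direct_sum_decomp_grade_mod4_nth) (simp, simp add: set_eq_iff, arith)
  \<comment> \<open>The index \<open>m\<close> is constrained by an equation, so each entry of the
    table becomes a numeral computation.\<close>
  have closed: "x * y + y * x \<in> grade_mod4 m"
    if "x \<in> grade_mod4 k" "y \<in> grade_mod4 l" "k < 4" "l < 4"
      "m = (k + l + 2 * (k * l)) mod 4" for x y k l m
    using anticommutator_grade_mod4[OF assms] that by simp
  show ?thesis
    unfolding quaternion_type_def Let_def
    by (intro conjI ballI;
        (rule assoc_algebra_axioms | rule exI, rule finite_dimensional
        | rule direct[unfolded list.map] | (rule closed, assumption, assumption; simp)))
qed

text \<open>The extra 2 translates the Klein four-group, so that its identity becomes 2; hence E is
  the component of residue 2 and the other three are shifted along with it.\<close>

lemma quaternion_type_commutator: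
  assumes "(2 :: 'k) \<noteq> 0"
  shows "quaternion_type scale (\<lambda>U V. U * V - V * U)
    (grade_mod4 2) (grade_mod4 3) (grade_mod4 0) (grade_mod4 1)"
proof -
  have direct: "direct_sum_decomp UNIV {..<4} (\<lambda>i. map grade_mod4 [2, 3, 0, 1] ! i)"
    by (rule direct_sum_decomp_grade_mod4_nth) (simp, simp add: set_eq_iff, arith)
  have closed: "x * y - y * x \<in> grade_mod4 m"
    if "x \<in> grade_mod4 k" "y \<in> grade_mod4 l" "k < 4" "l < 4"
      "m = (k + l + 2 * (k * l) + 2) mod 4" for x y k l m
    using commutator_grade_mod4[OF assms] that by simp
  show ?thesis
    unfolding quaternion_type_def Let_def
    by (intro conjI ballI;
        (rule assoc_algebra_axioms | rule exI, rule finite_dimensional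
        | rule direct[unfolded list.map] | (rule closed, assumption, assumption; simp)))
qed

end

theorem theorem3p1:
  fixes p q :: nat
    and scale\<^sub>R :: "real \<Rightarrow> 'a::ring_1 \<Rightarrow> 'a" and e\<^sub>R :: "nat \<Rightarrow> 'a"
    and scale\<^sub>C :: "complex \<Rightarrow> 'b::ring_1 \<Rightarrow> 'b" and e\<^sub>C :: "nat \<Rightarrow> 'b"
  assumes "p + q \<ge> 1"
  shows
    "(clifford_algebra scale\<^sub>R p q e\<^sub>R \<longrightarrow>
        (let Cl = clifford_algebra.grade_mod4 scale\<^sub>R p q e\<^sub>R in
          quaternion_type scale\<^sub>R (\<lambda>U V. U * V + V * U) (Cl 0) (Cl 1) (Cl 2) (Cl 3) \<and>
          quaternion_type scale\<^sub>R (\<lambda>U V. U * V - V * U) (Cl 2) (Cl 3) (Cl 0) (Cl 1))) \<and>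
     (clifford_algebra scale\<^sub>C p q e\<^sub>C \<longrightarrow>
        (let Cl = clifford_algebra.grade_mod4 scale\<^sub>C p q e\<^sub>C in
          quaternion_type scale\<^sub>C (\<lambda>U V. U * V + V * U) (Cl 0) (Cl 1) (Cl 2) (Cl 3) \<and>
          quaternion_type scale\<^sub>C (\<lambda>U V. U * V - V * U) (Cl 2) (Cl 3) (Cl 0) (Cl 1)))"
  unfolding Let_def
  \<comment> \<open>The real and complex cases differ only in the field; in both, 2 is
    nonzero.\<close>
  by (intro conjI impI;
      rule clifford_algebra.quaternion_type_anticommutator clifford_algebra.quaternion_type_commutator;
      (assumption | rule zero_neq_numeral[symmetric]))

end
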